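(* Let $\Bbbk$ be an algebraically closed field of characteristic zero, let $q\in\Bbbk^\ast\setminus\{1\}$, and let $A=\Bbbk_q[x,y]=\Bbbk\langle x,y\mid yx=qxy\rangle$ be the quantum plane. Let $D_x,D_y$ be the $\Bbbk$-derivations of $A$ determined by $D_x(x)=x$, $D_x(y)=0$, $D_y(x)=0$, $D_y(y)=y$. Then: (1) $D_x$ and $D_y$ are locally finite. (2) For $a\in A$, the inner derivation $\mathrm{ad}_a$ is locally finite if and only if $a\in Z(A)$. Moreover, if $D=fD_x+gD_y+\mathrm{ad}_a\in\mathrm{Der}(A)$, where $f,g\in Z(A)$ and $a\in A$, then $D$ is locally finite if and only if $D=\lambda D_x+\mu D_y$ for some $\lambda,\mu\in\Bbbk$.
   Context: $\mathrm{Der}(A)$ denotes the set of $\Bbbk$-linear derivations of the $\Bbbk$-algebra $A$, and $Z(A)$ denotes the center of $A$. For $a\in A$, $\mathrm{ad}_a(b)=ab-ba$. A derivation $D$ of a $\Bbbk$-algebra $A$ is locally finite if for every $a\in A$ the $\Bbbk$-vector space $\mathrm{Span}_\Bbbk\{D^n(a)\mid n\ge 0\}$ is finite-dimensional. No assumption is made on whether $q$ is a root of unity. *)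

theory Defs
  imports "HOL-Algebra.Algebra" "HOL-Algebra.Algebraic_Closure_Type" "HOL-Library.Poly_Mapping"
    "HOL-Library.FuncSet"
begin

section \<open>The quantum plane\<close>

text \<open>
  Words are written additively so that the convolution product of \<open>Poly_Mapping\<close> turns the
  finitely supported functions on words into the free associative unital algebra.
\<close>

datatype gen = GX | GY

datatype word = Word "gen list"

instantiation word :: monoid_add
begin

definition zero_word :: word where
  "0 = Word []"

fun plus_word :: "word \<Rightarrow> word \<Rightarrow> word" where
  "Word u + Word v = Word (u @ v)"

instance
proof
  fix a b c :: word
  show "a + b + c = a + (b + c)"
    by (cases a; cases b; cases c) simp
  show "0 + a = a" "a + 0 = a"
    by (cases a; simp add: zero_word_def)+
qed

end

type_synonym 'k free_alg = "word \<Rightarrow>\<^sub>0 'k"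

abbreviation free_algebra :: "'k::field free_alg ring" where
  "free_algebra \<equiv> ring_of_type_algebra"

definition fa_const :: "'k::field \<Rightarrow> 'k free_alg" where
  "fa_const c = Poly_Mapping.single 0 c"

definition fa_gen :: "gen \<Rightarrow> 'k::field free_alg" where
  "fa_gen g = Poly_Mapping.single (Word [g]) 1"

definition qp_ideal :: "'k::field \<Rightarrow> 'k free_alg set" where
  "qp_ideal q = Idl\<^bsub>free_algebra\<^esub> {fa_gen GY * fa_gen GX - fa_const q * fa_gen GX * fa_gen GY}"

text \<open>
  The library's \<^locale>\<open>algebra\<close> locale only covers commutative algebras, so the
  \<open>k\<close>-algebra structure is carried by the \<open>module\<close> record alone: the quotient ring, where
  \<open>c \<in> k\<close> acts as multiplication by the class of the constant \<open>c\<close>.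
\<close>

definition quantum_plane :: "'k::field \<Rightarrow> ('k, 'k free_alg set) module" where
  "quantum_plane q =
    (let Q = free_algebra Quot qp_ideal q
     in ring.extend Q (module.fields (\<lambda>c p. (qp_ideal q +>\<^bsub>free_algebra\<^esub> fa_const c) \<otimes>\<^bsub>Q\<^esub> p)))"

definition qp_gen :: "'k::field \<Rightarrow> gen \<Rightarrow> 'k free_alg set" where
  "qp_gen q g = qp_ideal q +>\<^bsub>free_algebra\<^esub> fa_gen g"


section \<open>Derivations and local finiteness\<close>

definition center :: "('a, 'm) ring_scheme \<Rightarrow> 'a set" where
  "center A = {z \<in> carrier A. \<forall>b \<in> carrier A. z \<otimes>\<^bsub>A\<^esub> b = b \<otimes>\<^bsub>A\<^esub> z}"

text \<open>
  Maps on \<open>A\<close> are taken extensional on the carrier, so that equality of derivations is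
  equality of functions.
\<close>

definition Der :: "('k, 'a, 'm) module_scheme \<Rightarrow> ('a \<Rightarrow> 'a) set" where
  "Der A = {D \<in> carrier A \<rightarrow>\<^sub>E carrier A.
     (\<forall>a \<in> carrier A. \<forall>b \<in> carrier A. D (a \<oplus>\<^bsub>A\<^esub> b) = D a \<oplus>\<^bsub>A\<^esub> D b) \<and>
     (\<forall>c. \<forall>a \<in> carrier A. D (c \<odot>\<^bsub>A\<^esub> a) = c \<odot>\<^bsub>A\<^esub> D a) \<and>
     (\<forall>a \<in> carrier A. \<forall>b \<in> carrier A. D (a \<otimes>\<^bsub>A\<^esub> b) = D a \<otimes>\<^bsub>A\<^esub> b \<oplus>\<^bsub>A\<^esub> a \<otimes>\<^bsub>A\<^esub> D b)}"

definition ad :: "('a, 'm) ring_scheme \<Rightarrow> 'a \<Rightarrow> 'a \<Rightarrow> 'a" where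
  "ad A a = (\<lambda>b \<in> carrier A. a \<otimes>\<^bsub>A\<^esub> b \<ominus>\<^bsub>A\<^esub> b \<otimes>\<^bsub>A\<^esub> a)"

definition lin_span :: "('k::field, 'a, 'm) module_scheme \<Rightarrow> 'a set \<Rightarrow> 'a set" where
  "lin_span A S = \<Inter>{V. submodule V (ring_of_type_algebra :: 'k ring) A \<and> S \<subseteq> V}"

definition finite_dim :: "('k::field, 'a, 'm) module_scheme \<Rightarrow> 'a set \<Rightarrow> bool" where
  "finite_dim A V \<longleftrightarrow> (\<exists>B \<subseteq> carrier A. finite B \<and> V = lin_span A B)"

definition locally_finite :: "('k::field, 'a, 'm) module_scheme \<Rightarrow> ('a \<Rightarrow> 'a) \<Rightarrow> bool" where
  "locally_finite A D \<longleftrightarrow>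
     D \<in> Der A \<and> (\<forall>a \<in> carrier A. finite_dim A (lin_span A (range (\<lambda>n. (D ^^ n) a))))"

end

theory Submission
  imports Defs "HOL-Library.Product_Plus" "HOL-Library.Product_Lexorder"
begin

text \<open>
  In the quantum plane the monomials \<open>x\<^sup>i y\<^sup>j\<close> form a basis, and
  \<open>x\<^sup>i y\<^sup>j \<cdot> x\<^sup>k y\<^sup>l = q\<^sup>j\<^sup>k x\<^sup>i\<^sup>+\<^sup>k y\<^sup>j\<^sup>+\<^sup>l\<close>. A derivation \<open>f D\<^sub>x + g D\<^sub>y + ad\<^sub>a\<close> therefore
  splits into finitely many homogeneous parts: the part of degree \<open>(i, j)\<close> sends \<open>x\<^sup>k y\<^sup>l\<close> to a
  scalar multiple of \<open>x\<^sup>i\<^sup>+\<^sup>k y\<^sup>j\<^sup>+\<^sup>l\<close>. The scalar, called the symbol, is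
  \<open>(k f\<^sub>i\<^sub>j + l g\<^sub>i\<^sub>j) q\<^sup>j\<^sup>k + a\<^sub>i\<^sub>j (q\<^sup>j\<^sup>k - q\<^sup>i\<^sup>l)\<close>.

  If the derivation has a part of non-zero degree, let \<open>d\<close> be its lexicographically largest
  degree. As long as the symbol does not vanish, applying the derivation shifts the leading
  monomial by \<open>d\<close>. A starting monomial for which the symbol never vanishes along the orbit
  exists (\<open>symbol_nonvanishing_orbit\<close>): centrality makes \<open>f\<^sub>i\<^sub>j\<close> and \<open>g\<^sub>i\<^sub>j\<close> vanish unless
  \<open>q\<^sup>i = q\<^sup>j = 1\<close>, so the symbol in degree \<open>d\<close> is either a linear form in \<open>(k, l)\<close> or a
  pure commutator factor. The orbit then involves infinitely many monomials and cannot span a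
  finite-dimensional space
  (\<open>not_locally_finite_if_leading_symbol\<close>).

  So a locally finite derivation of this form has only a part of degree zero, which is
  \<open>f\<^sub>0\<^sub>0 D\<^sub>x + g\<^sub>0\<^sub>0 D\<^sub>y\<close> because constants are central. Conversely
  \<open>\<lambda> D\<^sub>x + \<mu> D\<^sub>y\<close> is diagonal on monomials and hence locally finite. For an inner derivation the
  same argument with \<open>f = g = 0\<close> leaves \<open>ad\<^sub>a = 0\<close>, that is, \<open>a\<close> is central.

  The basis of monomials is obtained by identifying the defining ideal of the free algebra
  with the kernel of an explicit sorting map (\<open>qp_ideal_iff\<close>).
\<close>

section \<open>Normal forms in the free algebra\<close>

fun bidegree :: "word \<Rightarrow> nat \<times> nat" where
  "bidegree (Word w) = (count_list w GX, count_list w GY)"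

text \<open>
  A pair of letters \<open>y\<close> before \<open>x\<close> is an inversion. Sorting a word into the form
  \<open>x\<^sup>i y\<^sup>j\<close> removes its inversions one by one, each at the cost of a factor \<open>q\<close>.
\<close>

fun inversions_list :: "gen list \<Rightarrow> nat" where
  "inversions_list [] = 0"
| "inversions_list (GX # w) = inversions_list w"
| "inversions_list (GY # w) = count_list w GX + inversions_list w"

fun inversions :: "word \<Rightarrow> nat" where
  "inversions (Word w) = inversions_list w"

fun ordered_word :: "nat \<times> nat \<Rightarrow> word" where
  "ordered_word (i, j) = Word (replicate i GX @ replicate j GY)"

text \<open>
  The coefficient at \<open>x\<^sup>i y\<^sup>j\<close>, where \<open>s = (i, j)\<close>, after every word of \<open>p\<close> has been sorted.
  Only finitely many words have a given bidegree, so summing over all of them, and not just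
  over the support of \<open>p\<close>, makes linearity in \<open>p\<close> immediate.
\<close>

definition qp_coeff :: "'k::field \<Rightarrow> 'k free_alg \<Rightarrow> nat \<times> nat \<Rightarrow> 'k" where
  "qp_coeff q p s = (\<Sum>w | bidegree w = s. Poly_Mapping.lookup p w * q ^ inversions w)"

definition splits :: "nat \<times> nat \<Rightarrow> ((nat \<times> nat) \<times> (nat \<times> nat)) set" where
  "splits s = {(t, u). t + u = s}"

lemma finite_splits [simp]: "finite (splits s)"
proof (rule finite_subset)
  show "splits s \<subseteq> ({..fst s} \<times> {..snd s}) \<times> ({..fst s} \<times> {..snd s})"
    by (auto simp: splits_def)
qed auto

lemma sum_splits_single:
  assumes "a + b = s" "\<And>t u. t + u = s \<Longrightarrow> (t, u) \<noteq> (a, b) \<Longrightarrow> h t u = 0"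
  shows "(\<Sum>(t, u)\<in>splits s. h t u) = h a b"
proof -
  have "(\<Sum>(t, u)\<in>splits s. h t u) = (\<Sum>(t, u)\<in>{(a, b)}. h t u)"
    by (rule sum.mono_neutral_right[OF finite_splits]) (use assms in \<open>auto simp: splits_def\<close>)
  then show ?thesis by simp
qed

lemma count_list_replicate [simp]: "count_list (replicate n g) h = (if g = h then n else 0)"
  by (induction n) auto

lemma length_eq_counts: "length w = count_list w GX + count_list w GY"
proof (induction w)
  case (Cons g w)
  then show ?case by (cases g) auto
qed simp

lemma finite_bidegree [simp]: "finite {w. bidegree w = s}"
proof -
  have "{w. bidegree w = s} \<subseteq> Word ` {xs. set xs \<subseteq> {GX, GY} \<and> length xs = fst s + snd s}"
  proof
    fix w assume "w \<in> {w. bidegree w = s}"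
    moreover have "g \<in> {GX, GY}" for g by (cases g) auto
    ultimately show "w \<in> Word ` {xs. set xs \<subseteq> {GX, GY} \<and> length xs = fst s + snd s}"
      by (cases w) (auto simp: length_eq_counts intro!: imageI)
  qed
  then show ?thesis
    by (rule finite_subset) (simp add: finite_lists_length_eq)
qed

lemma bidegree_add: "bidegree (u + v) = bidegree u + bidegree v"
  by (cases u; cases v) auto

lemma inversions_add:
  "inversions (u + v) = inversions u + inversions v + snd (bidegree u) * fst (bidegree v)"
proof -
  have "inversions_list (xs @ ys)
      = inversions_list xs + inversions_list ys + count_list xs GY * count_list ys GX" for xs ys
    by (induction xs rule: inversions_list.induct) auto
  then show ?thesis by (cases u; cases v) auto
qed

lemma poly_mapping_as_sum_singles:
  fixes p :: "'a \<Rightarrow>\<^sub>0 'b::comm_monoid_add"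
  shows "p = (\<Sum>w\<in>Poly_Mapping.keys p. Poly_Mapping.single w (Poly_Mapping.lookup p w))"
proof (rule poly_mapping_eqI)
  fix v
  show "Poly_Mapping.lookup p v
    = Poly_Mapping.lookup (\<Sum>w\<in>Poly_Mapping.keys p. Poly_Mapping.single w (Poly_Mapping.lookup p w)) v"
    by (simp add: lookup_sum lookup_single when_def in_keys_iff)
qed

lemma poly_mapping_single_induct [case_names zero single add]:
  fixes p :: "'a \<Rightarrow>\<^sub>0 'b::comm_monoid_add"
  assumes "P 0" "\<And>w c. P (Poly_Mapping.single w c)" "\<And>p r. P p \<Longrightarrow> P r \<Longrightarrow> P (p + r)"
  shows "P p"
proof -
  have "P (\<Sum>w\<in>F. Poly_Mapping.single w (Poly_Mapping.lookup p w))" if "finite F" for F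
    using that by induction (use assms in auto)
  from this[of "Poly_Mapping.keys p"] show ?thesis
    using poly_mapping_as_sum_singles[of p] by simp
qed

lemma qp_coeff_zero [simp]: "qp_coeff q 0 s = 0"
  by (simp add: qp_coeff_def)

lemma qp_coeff_add: "qp_coeff q (p + r) s = qp_coeff q p s + qp_coeff q r s"
  by (simp add: qp_coeff_def lookup_add algebra_simps sum.distrib)

lemma qp_coeff_diff: "qp_coeff q (p - r) s = qp_coeff q p s - qp_coeff q r s"
  by (simp add: qp_coeff_def lookup_minus algebra_simps sum_subtractf)

lemma qp_coeff_single:
  "qp_coeff q (Poly_Mapping.single w c) s = (if s = bidegree w then c * q ^ inversions w else 0)"
proof -
  have "qp_coeff q (Poly_Mapping.single w c) s
    = (\<Sum>v | bidegree v = s. if v = w then c * q ^ inversions w else 0)"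
    unfolding qp_coeff_def by (rule sum.cong) (auto simp: lookup_single when_def)
  then show ?thesis by simp
qed

text \<open>
  Sorting a concatenation of two sorted words moves each \<open>y\<close> of the left one past each \<open>x\<close> of
  the right one. The identity is bilinear, so it suffices to compare both sides on words. It
  makes the kernel of the coefficient map an ideal and later gives every product in the
  quantum plane.
\<close>

lemma qp_coeff_mult:
  "qp_coeff q (p * r) s
    = (\<Sum>(t, u)\<in>splits s. qp_coeff q p t * qp_coeff q r u * q ^ (snd t * fst u))"
proof (induction p rule: poly_mapping_single_induct)
  case (single v c)
  show ?case
  proof (induction r rule: poly_mapping_single_induct)
    case (single w d)
    let ?e = "c * d * q ^ (inversions v + inversions w + snd (bidegree v) * fst (bidegree w))"
    have "(\<Sum>(t, u)\<in>splits s. qp_coeff q (Poly_Mapping.single v c) t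
          * qp_coeff q (Poly_Mapping.single w d) u * q ^ (snd t * fst u))
        = (\<Sum>tu\<in>splits s. if tu = (bidegree v, bidegree w) then ?e else 0)"
    proof (rule sum.cong[OF refl])
      fix tu assume "tu \<in> splits s"
      obtain t u where tu: "tu = (t, u)" by (cases tu)
      show "(case tu of (t, u) \<Rightarrow> qp_coeff q (Poly_Mapping.single v c) t
            * qp_coeff q (Poly_Mapping.single w d) u * q ^ (snd t * fst u))
          = (if tu = (bidegree v, bidegree w) then ?e else 0)"
        unfolding tu
        by (cases "t = bidegree v"; cases "u = bidegree w") (simp_all add: qp_coeff_single power_add)
    qed
    also have "\<dots> = (if s = bidegree v + bidegree w then ?e else 0)"
      by (subst sum.delta[OF finite_splits]) (auto simp: splits_def)
    finally show ?case
      by (simp add: mult_single qp_coeff_single bidegree_add inversions_add)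
  qed (simp_all add: qp_coeff_add distrib_left distrib_right sum.distrib split_def)
qed (simp_all add: qp_coeff_add distrib_left distrib_right sum.distrib split_def)

lemma finite_qp_coeff: "finite {s. qp_coeff q p s \<noteq> 0}"
proof (rule finite_subset)
  show "{s. qp_coeff q p s \<noteq> 0} \<subseteq> bidegree ` Poly_Mapping.keys p"
  proof
    fix s assume "s \<in> {s. qp_coeff q p s \<noteq> 0}"
    then obtain w where "w \<in> {w. bidegree w = s}" "Poly_Mapping.lookup p w * q ^ inversions w \<noteq> 0"
      unfolding qp_coeff_def by (metis (mono_tags, lifting) mem_Collect_eq sum.not_neutral_contains_not_neutral)
    then show "s \<in> bidegree ` Poly_Mapping.keys p"
      by (auto simp: in_keys_iff)
  qed
qed simp

section \<open>The defining ideal is the kernel of the coefficient map\<close>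

lemma free_algebra_simps [simp]:
  "carrier (free_algebra :: 'k::field free_alg ring) = UNIV"
  "p \<otimes>\<^bsub>free_algebra\<^esub> r = p * (r :: 'k::field free_alg)"
  "p \<oplus>\<^bsub>free_algebra\<^esub> r = p + (r :: 'k::field free_alg)"
  "\<one>\<^bsub>free_algebra\<^esub> = (1 :: 'k::field free_alg)"
  "\<zero>\<^bsub>free_algebra\<^esub> = (0 :: 'k::field free_alg)"
  by (simp_all add: ring_of_type_algebra_def)

lemma ring_free_algebra: "ring (free_algebra :: 'k::field free_alg ring)"
proof (rule ringI)
  show "abelian_group (free_algebra :: 'k free_alg ring)"
  proof (rule abelian_groupI)
    fix p :: "'k free_alg"
    assume "p \<in> carrier free_algebra"
    show "\<exists>r\<in>carrier free_algebra. r \<oplus>\<^bsub>free_algebra\<^esub> p = \<zero>\<^bsub>free_algebra\<^esub>"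
      by (rule bexI[of _ "- p"]) auto
  qed (auto simp: algebra_simps)
  show "Group.monoid (free_algebra :: 'k free_alg ring)"
    by (rule monoidI) (auto simp: algebra_simps)
qed (auto simp: algebra_simps)

interpretation free: ring "free_algebra :: 'k::field free_alg ring"
  by (rule ring_free_algebra)

lemma free_algebra_uminus [simp]: "\<ominus>\<^bsub>free_algebra\<^esub> p = - (p :: 'k::field free_alg)"
  by (rule free.minus_equality) auto

lemma free_algebra_minus [simp]: "p \<ominus>\<^bsub>free_algebra\<^esub> r = p - (r :: 'k::field free_alg)"
  by (simp add: a_minus_def)

lemma ideal_qp_ideal: "ideal (qp_ideal q) (free_algebra :: 'k::field free_alg ring)"
  unfolding qp_ideal_def by (rule free.genideal_ideal) simp

lemma qp_ideal_closed:
  "0 \<in> qp_ideal q" "p \<in> qp_ideal q \<Longrightarrow> r \<in> qp_ideal q \<Longrightarrow> p + r \<in> qp_ideal q"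
  "p \<in> qp_ideal q \<Longrightarrow> r * p \<in> qp_ideal q" "p \<in> qp_ideal q \<Longrightarrow> p * r \<in> qp_ideal q"
proof -
  interpret qp: ideal "qp_ideal q" free_algebra by (rule ideal_qp_ideal)
  show "0 \<in> qp_ideal q" "p \<in> qp_ideal q \<Longrightarrow> r \<in> qp_ideal q \<Longrightarrow> p + r \<in> qp_ideal q"
    "p \<in> qp_ideal q \<Longrightarrow> r * p \<in> qp_ideal q" "p \<in> qp_ideal q \<Longrightarrow> p * r \<in> qp_ideal q"
    using qp.zero_closed qp.a_closed[of p r] qp.I_l_closed[of p r] qp.I_r_closed[of p r] by simp_all
qed

lemma qp_ideal_diff_trans:
  "p - r \<in> qp_ideal q \<Longrightarrow> r - s \<in> qp_ideal q \<Longrightarrow> p - s \<in> qp_ideal q"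
  using qp_ideal_closed(2)[of "p - r" q "r - s"] by simp

text \<open>
  The kernel of the coefficient map is an ideal by the product formula and contains the
  defining relation, hence contains the ideal that the relation generates. This is the linear
  independence of the monomials \<open>x\<^sup>i y\<^sup>j\<close> modulo the relation.
\<close>

lemma qp_coeff_ideal:
  assumes "p \<in> qp_ideal q"
  shows "qp_coeff q p s = 0"
proof -
  let ?K = "{p. \<forall>s. qp_coeff q p s = 0}"
  have "ideal ?K (free_algebra :: 'a free_alg ring)"
  proof (rule idealI[OF ring_free_algebra])
    show "subgroup ?K (add_monoid (free_algebra :: 'a free_alg ring))"
    proof (rule group.subgroupI[OF free.add.group_axioms])
      fix p assume "p \<in> ?K"
      then show "inv\<^bsub>add_monoid free_algebra\<^esub> p \<in> ?K"
        unfolding a_inv_def[symmetric] free_algebra_uminus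
        using qp_coeff_diff[of q 0 p] by simp
    qed (auto simp: qp_coeff_add intro: exI[of _ 0])
  qed (auto simp: qp_coeff_mult simp del: split_paired_All intro!: sum.neutral)
  moreover have "fa_gen GY * fa_gen GX - fa_const q * fa_gen GX * fa_gen GY \<in> ?K"
    by (auto simp: qp_coeff_diff fa_gen_def fa_const_def mult_single qp_coeff_single zero_word_def)
  ultimately have "qp_ideal q \<subseteq> ?K"
    unfolding qp_ideal_def by (intro free.genideal_minimal) auto
  with assms show ?thesis by blast
qed

lemma qp_relation:
  "Poly_Mapping.single (Word [GY, GX]) 1 - Poly_Mapping.single (Word [GX, GY]) q \<in> qp_ideal q"
  using free.genideal_self'[of "fa_gen GY * fa_gen GX - fa_const q * fa_gen GX * fa_gen GY"]
  by (simp add: qp_ideal_def fa_gen_def fa_const_def mult_single zero_word_def)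

lemma reorder_GY:
  "Poly_Mapping.single (Word (GY # replicate i GX @ v)) 1
    - Poly_Mapping.single (Word (replicate i GX @ GY # v)) (q ^ i) \<in> qp_ideal q"
proof (induction i)
  case 0
  then show ?case by (simp add: qp_ideal_closed)
next
  case (Suc i)
  have "Poly_Mapping.single (Word (GY # replicate (Suc i) GX @ v)) 1
      - Poly_Mapping.single (Word (GX # GY # replicate i GX @ v)) q \<in> qp_ideal q"
    using qp_ideal_closed(4)[OF qp_relation, of q "Poly_Mapping.single (Word (replicate i GX @ v)) 1"]
    by (simp add: left_diff_distrib mult_single)
  moreover have "Poly_Mapping.single (Word (GX # GY # replicate i GX @ v)) q
      - Poly_Mapping.single (Word (replicate (Suc i) GX @ GY # v)) (q ^ Suc i) \<in> qp_ideal q"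
    using qp_ideal_closed(3)[OF Suc, of "Poly_Mapping.single (Word [GX]) q"]
    by (simp add: right_diff_distrib mult_single)
  ultimately show ?case by (rule qp_ideal_diff_trans)
qed

text \<open>
  Sorting is compatible with the relation: after the tail of the word has been sorted, only
  a leading \<open>y\<close> has to be moved past a block of letters \<open>x\<close>. So the monomials
  \<open>x\<^sup>i y\<^sup>j\<close> span the quotient.
\<close>

lemma reorder_list:
  "Poly_Mapping.single (Word w) 1
    - Poly_Mapping.single (ordered_word (bidegree (Word w))) (q ^ inversions_list w) \<in> qp_ideal q"
proof (induction w)
  case Nil
  then show ?case by (simp add: qp_ideal_closed)
next
  case (Cons g w)
  let ?i = "count_list w GX" and ?j = "count_list w GY" and ?n = "inversions_list w"
  have step: "Poly_Mapping.single (Word (g # w)) 1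
      - Poly_Mapping.single (Word (g # replicate ?i GX @ replicate ?j GY)) (q ^ ?n) \<in> qp_ideal q"
    using qp_ideal_closed(3)[OF Cons, of "Poly_Mapping.single (Word [g]) 1"]
    by (simp add: right_diff_distrib mult_single)
  show ?case
  proof (cases g)
    case GX
    with step show ?thesis by simp
  next
    case GY
    have "Poly_Mapping.single (Word (GY # replicate ?i GX @ replicate ?j GY)) (q ^ ?n)
      - Poly_Mapping.single (Word (replicate ?i GX @ GY # replicate ?j GY)) (q ^ (?i + ?n))
      \<in> qp_ideal q"
      using qp_ideal_closed(3)[OF reorder_GY[of ?i "replicate ?j GY" q],
          of "Poly_Mapping.single (Word []) (q ^ ?n)"]
      by (simp add: right_diff_distrib mult_single power_add mult.commute)
    with step show ?thesis
      unfolding GY using qp_ideal_diff_trans by fastforce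
  qed
qed

lemma qp_ideal_sum: "(\<And>w. w \<in> F \<Longrightarrow> f w \<in> qp_ideal q) \<Longrightarrow> sum f F \<in> qp_ideal q"
  by (induction F rule: infinite_finite_induct) (auto simp: qp_ideal_closed)

lemma single_sum: "Poly_Mapping.single w (sum f F) = (\<Sum>i\<in>F. Poly_Mapping.single w (f i))"
  by (induction F rule: infinite_finite_induct) (auto simp: Poly_Mapping.single_add)

text \<open>
  Modulo the ideal, \<open>p\<close> agrees with the element obtained by sorting each of its words.
  Collecting the sorted words by bidegree turns the coefficients of that element into the
  values of \<^const>\<open>qp_coeff\<close>, so it vanishes as soon as these do.
\<close>

lemma qp_ideal_iff: "p \<in> qp_ideal q \<longleftrightarrow> (\<forall>s. qp_coeff q p s = 0)"
proof
  assume 0: "\<forall>s. qp_coeff q p s = 0"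
  let ?K = "Poly_Mapping.keys p" and ?c = "\<lambda>w. Poly_Mapping.lookup p w"
  let ?N = "\<lambda>w. Poly_Mapping.single (ordered_word (bidegree w)) (?c w * q ^ inversions w)"
  have "(\<Sum>w\<in>?K. ?N w) = (\<Sum>s\<in>bidegree ` ?K. \<Sum>w | w \<in> ?K \<and> bidegree w = s. ?N w)"
    by (rule sum.image_gen) simp
  also have "\<dots> = (\<Sum>s\<in>bidegree ` ?K. Poly_Mapping.single (ordered_word s) (qp_coeff q p s))"
  proof (rule sum.cong[OF refl])
    fix s
    have "qp_coeff q p s = (\<Sum>w | w \<in> ?K \<and> bidegree w = s. ?c w * q ^ inversions w)"
      unfolding qp_coeff_def by (rule sum.mono_neutral_right) (auto simp: in_keys_iff)
    then show "(\<Sum>w | w \<in> ?K \<and> bidegree w = s. ?N w)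
        = Poly_Mapping.single (ordered_word s) (qp_coeff q p s)"
      by (simp add: single_sum)
  qed
  finally have N0: "(\<Sum>w\<in>?K. ?N w) = 0" using 0 by simp
  have "p - (\<Sum>w\<in>?K. ?N w) = (\<Sum>w\<in>?K. Poly_Mapping.single w (?c w) - ?N w)"
    using poly_mapping_as_sum_singles[of p] by (simp add: sum_subtractf)
  also have "\<dots> \<in> qp_ideal q"
  proof (rule qp_ideal_sum)
    fix w
    obtain u where w: "w = Word u" by (cases w)
    show "Poly_Mapping.single w (?c w) - ?N w \<in> qp_ideal q"
      using qp_ideal_closed(3)[OF reorder_list[of u q], of "Poly_Mapping.single 0 (?c w)"]
      by (simp add: right_diff_distrib mult_single w)
  qed
  finally show "p \<in> qp_ideal q" by (simp add: N0)
qed (simp add: qp_coeff_ideal)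

section \<open>The quantum plane\<close>

definition qp_class :: "'k::field \<Rightarrow> 'k free_alg \<Rightarrow> 'k free_alg set" where
  "qp_class q p = qp_ideal q +>\<^bsub>free_algebra\<^esub> p"

lemma qp_class_eq_iff: "qp_class q p = qp_class q r \<longleftrightarrow> (\<forall>s. qp_coeff q p s = qp_coeff q r s)"
  using free.quotient_eq_iff_same_a_r_cos[OF ideal_qp_ideal, of p r q]
  by (simp add: qp_class_def qp_ideal_iff qp_coeff_diff)

lemma quantum_plane_simps:
  "carrier (quantum_plane q) = range (qp_class q)"
  "qp_class q p \<oplus>\<^bsub>quantum_plane q\<^esub> qp_class q r = qp_class q (p + r)"
  "qp_class q p \<otimes>\<^bsub>quantum_plane q\<^esub> qp_class q r = qp_class q (p * r)"
  "c \<odot>\<^bsub>quantum_plane q\<^esub> qp_class q r = qp_class q (fa_const c * r)"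
  "\<zero>\<^bsub>quantum_plane q\<^esub> = qp_class q 0"
  "\<one>\<^bsub>quantum_plane q\<^esub> = qp_class q 1"
proof -
  interpret qp: ideal "qp_ideal q" free_algebra by (rule ideal_qp_ideal)
  have mult: "rcoset_mult free_algebra (qp_ideal q) (qp_class q a) (qp_class q b) = qp_class q (a * b)"
    for a b
    using qp.rcoset_mult_add[of a b] by (simp add: qp_class_def)
  note defs = quantum_plane_def Let_def ring.defs module.defs FactRing_def
  show "carrier (quantum_plane q) = range (qp_class q)"
    by (auto simp: defs A_RCOSETS_def RCOSETS_def qp_class_def a_r_coset_def)
  show "qp_class q p \<oplus>\<^bsub>quantum_plane q\<^esub> qp_class q r = qp_class q (p + r)"
    using qp.a_rcos_sum[of p r] by (simp add: defs qp_class_def)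
  show "qp_class q p \<otimes>\<^bsub>quantum_plane q\<^esub> qp_class q r = qp_class q (p * r)"
    by (simp add: defs mult)
  show "c \<odot>\<^bsub>quantum_plane q\<^esub> qp_class q r = qp_class q (fa_const c * r)"
    by (simp add: defs mult qp_class_def[symmetric])
  show "\<zero>\<^bsub>quantum_plane q\<^esub> = qp_class q 0"
    using free.a_coset_add_zero[of "qp_ideal q"] by (simp add: defs qp_class_def)
  show "\<one>\<^bsub>quantum_plane q\<^esub> = qp_class q 1"
    by (simp add: defs qp_class_def)
qed

lemma qp_carrierE:
  assumes "a \<in> carrier (quantum_plane q)"
  obtains p where "a = qp_class q p"
  using assms by (auto simp: quantum_plane_simps)

lemma ring_quantum_plane: "ring (quantum_plane q)"

proof (rule ringI)
  show "abelian_group (quantum_plane q)"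
  proof (rule abelian_groupI)
    fix a assume "a \<in> carrier (quantum_plane q)"
    then obtain p where "a = qp_class q p" by (rule qp_carrierE)
    then show "\<exists>b\<in>carrier (quantum_plane q). b \<oplus>\<^bsub>quantum_plane q\<^esub> a = \<zero>\<^bsub>quantum_plane q\<^esub>"
      by (intro bexI[of _ "qp_class q (- p)"]) (auto simp: quantum_plane_simps)
  qed (auto elim!: qp_carrierE simp: quantum_plane_simps algebra_simps)
  show "Group.monoid (quantum_plane q)"
    by (rule monoidI) (auto elim!: qp_carrierE simp: quantum_plane_simps algebra_simps)
qed (auto elim!: qp_carrierE simp: quantum_plane_simps algebra_simps)

lemma module_quantum_plane:
  "module (ring_of_type_algebra :: 'k::field ring) (quantum_plane (q :: 'k))"
proof (rule moduleI)
  show "abelian_group (quantum_plane q)"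
    using ring_quantum_plane by (rule ring.is_abelian_group)
  show "cring (ring_of_type_algebra :: 'k ring)" ..
qed (auto elim!: qp_carrierE simp: quantum_plane_simps ring_of_type_algebra_def
      distrib_left distrib_right fa_const_def Poly_Mapping.single_add mult_single
      mult.assoc[symmetric])

text \<open>
  The coefficients of a coset are those of any representative.
\<close>

definition qp_coord :: "'k::field \<Rightarrow> 'k free_alg set \<Rightarrow> nat \<times> nat \<Rightarrow> 'k" where
  "qp_coord q a = qp_coeff q (SOME p. a = qp_class q p)"

lemma qp_coord_class [simp]: "qp_coord q (qp_class q p) = qp_coeff q p"
proof -
  have "qp_class q p = qp_class q (SOME r. qp_class q p = qp_class q r)"
    by (rule someI[of _ p]) (rule refl)
  then have "qp_coeff q p s = qp_coeff q (SOME r. qp_class q p = qp_class q r) s" for s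
    using qp_class_eq_iff by blast
  then show ?thesis
    unfolding qp_coord_def by (intro ext) metis
qed

lemma DerD:
  assumes "D \<in> Der A" "a \<in> carrier A"
  shows "D a \<in> carrier A" "D (c \<odot>\<^bsub>A\<^esub> a) = c \<odot>\<^bsub>A\<^esub> D a"
    "b \<in> carrier A \<Longrightarrow> D (a \<oplus>\<^bsub>A\<^esub> b) = D a \<oplus>\<^bsub>A\<^esub> D b"
    "b \<in> carrier A \<Longrightarrow> D (a \<otimes>\<^bsub>A\<^esub> b) = D a \<otimes>\<^bsub>A\<^esub> b \<oplus>\<^bsub>A\<^esub> a \<otimes>\<^bsub>A\<^esub> D b"
  using assms by (auto simp: Der_def)

section \<open>Algebras with quantum plane coordinates\<close>

text \<open>
  The analysis of local finiteness only uses a coordinate system for which multiplication is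
  the twisted convolution above; the construction of the quantum plane as a quotient of the
  free algebra is hidden behind it. Equations in \<open>A\<close> are proved by comparing coordinates.
\<close>

locale quantum_coordinates = module "ring_of_type_algebra :: 'k::field_char_0 ring" A + A: ring A
  for A :: "('k::field_char_0, 'a, 'm) module_scheme" (structure) +
  fixes q :: 'k and coord :: "'a \<Rightarrow> nat \<times> nat \<Rightarrow> 'k"
  assumes q_nonzero: "q \<noteq> 0"
    and coord_add: "a \<in> carrier A \<Longrightarrow> b \<in> carrier A \<Longrightarrow> coord (a \<oplus>\<^bsub>A\<^esub> b) s = coord a s + coord b s"
    and coord_smult: "a \<in> carrier A \<Longrightarrow> coord (c \<odot>\<^bsub>A\<^esub> a) s = c * coord a s"
    and coord_mult: "a \<in> carrier A \<Longrightarrow> b \<in> carrier A \<Longrightarrow> coord (a \<otimes>\<^bsub>A\<^esub> b) s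
      = (\<Sum>(t, u)\<in>splits s. coord a t * coord b u * q ^ (snd t * fst u))"
    and coord_inject: "a \<in> carrier A \<Longrightarrow> b \<in> carrier A \<Longrightarrow> (\<And>s. coord a s = coord b s) \<Longrightarrow> a = b"
    and finite_support: "a \<in> carrier A \<Longrightarrow> finite {s. coord a s \<noteq> 0}"
    and ex_monomial: "\<exists>m\<in>carrier A. \<forall>s. coord m s = (if s = r then 1 else 0)"
begin

abbreviation K :: "'k ring" where "K \<equiv> ring_of_type_algebra"

lemma carrier_K [simp]: "c \<in> carrier K"
  by (simp add: ring_of_type_algebra_def)

lemma smult_in_carrier [simp]: "a \<in> carrier A \<Longrightarrow> c \<odot>\<^bsub>A\<^esub> a \<in> carrier A"
  using smult_closed[of c a] by simp

lemma coord_zero [simp]: "coord \<zero>\<^bsub>A\<^esub> s = 0"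
  using coord_add[of "\<zero>\<^bsub>A\<^esub>" "\<zero>\<^bsub>A\<^esub>" s] by simp

lemma coord_diff:
  assumes "a \<in> carrier A" "b \<in> carrier A"
  shows "coord (a \<ominus>\<^bsub>A\<^esub> b) s = coord a s - coord b s"
proof -
  have "(a \<ominus>\<^bsub>A\<^esub> b) \<oplus>\<^bsub>A\<^esub> b = a"
    using assms by (simp add: a_minus_def M.a_assoc M.l_neg)
  with coord_add[of "a \<ominus>\<^bsub>A\<^esub> b" b s] assms show ?thesis by simp
qed

lemma submodule_of_closed:
  assumes "H \<subseteq> carrier A" "\<zero>\<^bsub>A\<^esub> \<in> H"
    and "\<And>a b. a \<in> H \<Longrightarrow> b \<in> H \<Longrightarrow> a \<oplus>\<^bsub>A\<^esub> b \<in> H"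
    and smult: "\<And>c a. a \<in> H \<Longrightarrow> c \<odot>\<^bsub>A\<^esub> a \<in> H"
  shows "submodule H K A"
proof (rule submoduleI)
  fix a assume a: "a \<in> H"
  have "\<ominus>\<^bsub>A\<^esub> a = (- 1) \<odot>\<^bsub>A\<^esub> a"
  proof (rule coord_inject)
    fix s
    show "coord (\<ominus>\<^bsub>A\<^esub> a) s = coord ((- 1) \<odot>\<^bsub>A\<^esub> a) s"
      using a assms(1) coord_diff[of "\<zero>\<^bsub>A\<^esub>" a s] by (auto simp: a_minus_def coord_smult)
  qed (use a assms(1) in auto)
  with smult[OF a] show "\<ominus>\<^bsub>A\<^esub> a \<in> H" by simp
qed (use assms in auto)

lemma submodule_closed:
  assumes "submodule H K A"
  shows "H \<subseteq> carrier A" "\<zero>\<^bsub>A\<^esub> \<in> H"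
    "a \<in> H \<Longrightarrow> b \<in> H \<Longrightarrow> a \<oplus>\<^bsub>A\<^esub> b \<in> H" "a \<in> H \<Longrightarrow> c \<odot>\<^bsub>A\<^esub> a \<in> H"
proof -
  interpret H: submodule H K A by (rule assms)
  show "H \<subseteq> carrier A" "\<zero>\<^bsub>A\<^esub> \<in> H" "a \<in> H \<Longrightarrow> b \<in> H \<Longrightarrow> a \<oplus>\<^bsub>A\<^esub> b \<in> H"
    "a \<in> H \<Longrightarrow> c \<odot>\<^bsub>A\<^esub> a \<in> H"
    using H.subset H.one_closed H.m_closed[of a b] H.smult_closed[of c a] by auto
qed

lemma lin_span_least: "submodule V K A \<Longrightarrow> S \<subseteq> V \<Longrightarrow> lin_span A S \<subseteq> V"
  by (auto simp: lin_span_def)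

lemma subset_lin_span: "S \<subseteq> lin_span A S"
  by (auto simp: lin_span_def)

lemma submodule_lin_span:
  assumes "S \<subseteq> carrier A"
  shows "submodule (lin_span A S) K A"
proof (rule submodule_of_closed)
  show "lin_span A S \<subseteq> carrier A"
    by (rule lin_span_least[OF carrier_is_submodule assms])
qed (auto simp: lin_span_def dest: submodule_closed)

lemma submodule_supported: "submodule {a \<in> carrier A. \<forall>s. s \<notin> S \<longrightarrow> coord a s = 0} K A"
  by (rule submodule_of_closed) (auto simp: coord_add coord_smult)

text \<open>
  Subspaces of a finite-dimensional space are finite-dimensional, by elimination: a vector
  with non-zero coordinate at \<open>s\<close> clears that coordinate from all others, which leaves a
  subspace supported on one index fewer.
\<close>

lemma finitely_supported_submodule:
  assumes "finite S" "submodule V K A" "\<And>v s. v \<in> V \<Longrightarrow> s \<notin> S \<Longrightarrow> coord v s = 0"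
  shows "\<exists>B\<subseteq>V. finite B \<and> V = lin_span A B"
  using assms
proof (induction S arbitrary: V)
  case empty
  note V = submodule_closed[OF empty.prems(1)]
  have "V \<subseteq> {\<zero>\<^bsub>A\<^esub>}"
    using empty.prems(2) V(1) by (auto intro: coord_inject)
  moreover have "\<zero>\<^bsub>A\<^esub> \<in> lin_span A {}"
    by (rule submodule_closed(2)[OF submodule_lin_span]) simp
  ultimately show ?case
    using lin_span_least[OF empty.prems(1), of "{}"] by (intro exI[of _ "{}"]) auto
next
  case (insert s S)
  note V = submodule_closed[OF insert.prems(1)]
  show ?case
  proof (cases "\<forall>v\<in>V. coord v s = 0")
    case True
    then show ?thesis using insert by (metis insertE)
  next
    case False
    then obtain v where v: "v \<in> V" "coord v s \<noteq> 0" by blast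
    (* the vectors of V with coordinate zero at s: every other vector of V is reduced to one of
       these by subtracting a multiple of v *)
    let ?W = "{w \<in> V. coord w s = 0}"
    have "submodule ?W K A"
      by (rule submodule_of_closed) (use V in \<open>auto simp: coord_add coord_smult subset_iff\<close>)
    moreover have "coord w t = 0" if "w \<in> ?W" "t \<notin> S" for w t
      using that insert.prems(2)[of w t] by auto
    ultimately obtain B where B: "B \<subseteq> ?W" "finite B" "?W = lin_span A B"
      using insert.IH[of ?W] by blast
    have sub: "insert v B \<subseteq> V" using B(1) v(1) by auto
    then have L: "submodule (lin_span A (insert v B)) K A"
      using V(1) by (intro submodule_lin_span) auto
    have "w \<in> lin_span A (insert v B)" if w: "w \<in> V" for w
    proof -
      let ?c = "coord w s / coord v s"
      let ?w = "w \<oplus>\<^bsub>A\<^esub> (- ?c) \<odot>\<^bsub>A\<^esub> v"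
      have carr: "v \<in> carrier A" "w \<in> carrier A" using v(1) w V(1) by auto
      have "?w \<in> ?W"
        using v w carr V(3,4) by (auto simp: coord_add coord_smult)
      also have "\<dots> \<subseteq> lin_span A (insert v B)"
        unfolding B(3) by (rule lin_span_least[OF L]) (use subset_lin_span in blast)
      finally have "?w \<oplus>\<^bsub>A\<^esub> ?c \<odot>\<^bsub>A\<^esub> v \<in> lin_span A (insert v B)"
        using submodule_closed(3,4)[OF L] subset_lin_span[of "insert v B"] by auto
      moreover have "?w \<oplus>\<^bsub>A\<^esub> ?c \<odot>\<^bsub>A\<^esub> v = w"
        by (rule coord_inject) (use carr in \<open>auto simp: coord_add coord_smult\<close>)
      ultimately show ?thesis by simp
    qed
    then have "V = lin_span A (insert v B)"
      using lin_span_least[OF insert.prems(1) sub] by auto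
    with sub B(2) show ?thesis by blast
  qed
qed

text \<open>
  The only obstruction to finite dimension that is needed: finitely many generators involve
  finitely many monomials.
\<close>

lemma finite_dim_imp_finite_support:
  assumes "finite_dim A V"
  obtains S where "finite S" "\<And>v s. v \<in> V \<Longrightarrow> s \<notin> S \<Longrightarrow> coord v s = 0"
proof -
  from assms obtain B where B: "B \<subseteq> carrier A" "finite B" "V = lin_span A B"
    unfolding finite_dim_def by blast
  let ?S = "\<Union>b\<in>B. {s. coord b s \<noteq> 0}"
  have "V \<subseteq> {a \<in> carrier A. \<forall>s. s \<notin> ?S \<longrightarrow> coord a s = 0}"
    unfolding B(3) by (rule lin_span_least[OF submodule_supported]) (use B(1) in auto)
  moreover have "finite ?S"
    using B finite_support by auto
  ultimately show thesis by (intro that) auto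
qed

section \<open>Local finiteness read off from coordinates\<close>

lemma funpow_closed: "D \<in> Der A \<Longrightarrow> a \<in> carrier A \<Longrightarrow> (D ^^ n) a \<in> carrier A"
  by (induction n) (auto simp: DerD(1))

text \<open>
  An orbit never leaves the finite-dimensional space of elements supported where its
  starting point is.
\<close>

lemma locally_finite_if_support_preserving:
  assumes D: "D \<in> Der A"
    and supp: "\<And>b s. b \<in> carrier A \<Longrightarrow> coord b s = 0 \<Longrightarrow> coord (D b) s = 0"
  shows "locally_finite A D"
  unfolding locally_finite_def
proof (intro conjI ballI D)
  fix a assume a: "a \<in> carrier A"
  let ?S = "{s. coord a s \<noteq> 0}" and ?O = "range (\<lambda>n. (D ^^ n) a)"
  have "coord ((D ^^ n) a) s = 0" if "s \<notin> ?S" for n s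
    using that by (induction n) (auto intro!: supp funpow_closed D a)
  then have "lin_span A ?O \<subseteq> {b \<in> carrier A. \<forall>s. s \<notin> ?S \<longrightarrow> coord b s = 0}"
    by (intro lin_span_least[OF submodule_supported]) (auto intro!: funpow_closed D a)
  moreover have "submodule (lin_span A ?O) K A"
    by (rule submodule_lin_span) (auto intro!: funpow_closed D a)
  ultimately have "\<exists>B\<subseteq>lin_span A ?O. finite B \<and> lin_span A ?O = lin_span A B"
    by (intro finitely_supported_submodule[OF finite_support[OF a]]) auto
  moreover have "lin_span A ?O \<subseteq> carrier A"
    by (rule lin_span_least[OF carrier_is_submodule]) (auto intro!: funpow_closed D a)
  ultimately show "finite_dim A (lin_span A ?O)"
    unfolding finite_dim_def by blast
qed

lemma lex_add_mono:
  fixes t u d e :: "nat \<times> nat"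
  assumes "t \<le> d" "u \<le> e"
  shows "t + u \<le> d + e" "t + u = d + e \<Longrightarrow> t = d \<and> u = e"
  using assms by (cases t; cases u; cases d; cases e; auto)+

text \<open>
  Here \<open>C t u\<close> is the factor by which the part of \<open>D\<close> of degree \<open>t\<close> multiplies the monomial of
  bidegree \<open>u\<close>, and \<open>d\<close> is the lexicographically largest degree that occurs in \<open>D\<close>. Since the
  order is compatible with addition, the leading monomial of \<open>D b\<close> comes only from the leading
  monomial of \<open>b\<close> and is shifted by \<open>d\<close>, unless its factor vanishes. If the factors along
  \<open>r\<close>, \<open>r + d\<close>, \<open>r + 2d\<close>, \<open>...\<close> are all non-zero, the orbit of the monomial at \<open>r\<close>
  involves infinitely many monomials.
\<close>

lemma not_locally_finite_if_leading_symbol: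
  assumes conv: "\<And>b s. b \<in> carrier A \<Longrightarrow>
      coord (D b) s = (\<Sum>(t, u)\<in>splits s. C t u * coord b u)"
    and max: "\<And>t u. C t u \<noteq> 0 \<Longrightarrow> t \<le> d"
    and d: "d \<noteq> 0"
    and orbit: "\<And>n. C d (r + (n * fst d, n * snd d)) \<noteq> 0"
  shows "\<not> locally_finite A D"
proof
  assume lf: "locally_finite A D"
  then have D: "D \<in> Der A" by (simp add: locally_finite_def)
  have lead: "coord (D b) (d + e) \<noteq> 0 \<and> (\<forall>s. coord (D b) s \<noteq> 0 \<longrightarrow> s \<le> d + e)"
    if b: "b \<in> carrier A" and e: "coord b e \<noteq> 0" and top: "\<forall>s. coord b s \<noteq> 0 \<longrightarrow> s \<le> e"
      and C: "C d e \<noteq> 0" for b e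
  proof
    have "coord (D b) (d + e) = C d e * coord b e"
      unfolding conv[OF b]
    proof (rule sum_splits_single[OF refl])
      fix t u assume tu: "t + u = d + e" "(t, u) \<noteq> (d, e)"
      show "C t u * coord b u = 0"
        using lex_add_mono(2)[of t d u e] max[of t u] top tu by (metis mult_eq_0_iff)
    qed
    then show "coord (D b) (d + e) \<noteq> 0" using C e by simp
    show "\<forall>s. coord (D b) s \<noteq> 0 \<longrightarrow> s \<le> d + e"
    proof (intro allI impI)
      fix s assume "coord (D b) s \<noteq> 0"
      then obtain tu where "tu \<in> splits s" "(case tu of (t, u) \<Rightarrow> C t u * coord b u) \<noteq> 0"
        unfolding conv[OF b] by (meson sum.not_neutral_contains_not_neutral)
      then obtain t u where "t + u = s" "C t u \<noteq> 0" "coord b u \<noteq> 0"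
        by (auto simp: splits_def)
      then show "s \<le> d + e"
        using lex_add_mono(1)[of t d u e] max[of t u] top by blast
    qed
  qed
  obtain m where m: "m \<in> carrier A" "\<And>s. coord m s = (if s = r then 1 else 0)"
    using ex_monomial by blast
  let ?e = "\<lambda>n. r + (n * fst d, n * snd d)"
  have step: "d + ?e n = ?e (Suc n)" for n
    by (cases d; cases r) auto
  have iter: "coord ((D ^^ n) m) (?e n) \<noteq> 0 \<and> (\<forall>s. coord ((D ^^ n) m) s \<noteq> 0 \<longrightarrow> s \<le> ?e n)" for n
  proof (induction n)
    case 0
    then show ?case using m(2) by (cases r) auto
  next
    case (Suc n)
    then show ?case
      using lead[of "(D ^^ n) m" "?e n"] orbit[of n] funpow_closed[OF D m(1)] step[of n] by simp
  qed
  from lf m(1) have "finite_dim A (lin_span A (range (\<lambda>n. (D ^^ n) m)))"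
    by (simp add: locally_finite_def)
  then obtain S where S: "finite S"
      "\<And>v s. v \<in> lin_span A (range (\<lambda>n. (D ^^ n) m)) \<Longrightarrow> s \<notin> S \<Longrightarrow> coord v s = 0"
    by (rule finite_dim_imp_finite_support) blast
  have "range ?e \<subseteq> S"
    using iter S(2) subset_lin_span by blast
  then have "finite (range ?e)" using S(1) by (rule finite_subset)
  moreover have "inj ?e"
    using d by (intro injI) (cases d; cases r; auto simp: zero_prod_def)
  ultimately show False
    using finite_imageD by blast
qed

end

section \<open>Symbols\<close>

text \<open>
  For central \<open>f\<close> and \<open>g\<close>, the derivation \<open>f D\<^sub>x + g D\<^sub>y + ad\<^sub>a\<close> splits into parts that raise the
  bidegree by a fixed \<open>t\<close>. With \<open>F\<close>, \<open>G\<close>, \<open>H\<close> the coordinates of \<open>f\<close>, \<open>g\<close>, \<open>a\<close>, the symbol is the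
  scalar by which that part acts on the monomial of bidegree \<open>u\<close>.
\<close>

definition symbol :: "'k::field \<Rightarrow> (nat \<times> nat \<Rightarrow> 'k) \<Rightarrow> (nat \<times> nat \<Rightarrow> 'k) \<Rightarrow> (nat \<times> nat \<Rightarrow> 'k)
    \<Rightarrow> nat \<times> nat \<Rightarrow> nat \<times> nat \<Rightarrow> 'k" where
  "symbol q F G H t u = (F t * of_nat (fst u) + G t * of_nat (snd u)) * q ^ (snd t * fst u)
    + H t * (q ^ (snd t * fst u) - q ^ (snd u * fst t))"

text \<open>
  If \<open>q\<^sup>i = q\<^sup>j = 1\<close> for \<open>d = (i, j)\<close>, the commutator part vanishes and the symbol is a linear form
  in \<open>u\<close>. Its value along \<open>d\<close>, \<open>2d\<close>, \<open>3d\<close>, \<open>...\<close> is a positive multiple of its value at \<open>d\<close>, which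
  settles characteristic zero unless the form vanishes at \<open>d\<close>; then it is constant along
  every line of direction \<open>d\<close>. Otherwise \<open>f\<close> and \<open>g\<close> do not contribute, and shifting \<open>u\<close> by \<open>d\<close>
  only multiplies the commutator factor by a power of \<open>q\<close>; this factor is non-zero at \<open>x\<close> or
  at \<open>y\<close>.
\<close>

lemma symbol_nonvanishing_orbit:
  fixes q :: "'k::field_char_0"
  assumes q: "q \<noteq> 0" and d: "d \<noteq> 0"
    and central: "F d \<noteq> 0 \<or> G d \<noteq> 0 \<Longrightarrow> q ^ fst d = 1 \<and> q ^ snd d = 1"
    and nz: "symbol q F G H d u \<noteq> 0"
  obtains r where "\<And>n. symbol q F G H d (r + (n * fst d, n * snd d)) \<noteq> 0"
proof (cases "q ^ fst d = 1 \<and> q ^ snd d = 1")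
  case True
  then have p1: "q ^ (snd d * n) = 1" "q ^ (n * fst d) = 1" for n
    by (simp_all add: power_mult) (metis mult.commute power_mult power_one)
  have sym: "symbol q F G H d v = F d * of_nat (fst v) + G d * of_nat (snd v)" for v
    by (simp add: symbol_def p1)
  let ?c = "F d * of_nat (fst d) + G d * of_nat (snd d)"
  show ?thesis
  proof (cases "?c = 0")
    case True
    have "symbol q F G H d (u + (n * fst d, n * snd d)) = symbol q F G H d u + of_nat n * ?c" for n
      by (simp add: sym algebra_simps)
    with True nz show ?thesis by (intro that[of u]) simp
  next
    case False
    have "symbol q F G H d (d + (n * fst d, n * snd d)) = of_nat (Suc n) * ?c" for n
      by (simp add: sym algebra_simps)
    with False show ?thesis by (intro that[of d]) (simp del: of_nat_Suc)
  qed
next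
  case False
  with central have FG: "F d = 0" "G d = 0" by auto
  with nz have H: "H d \<noteq> 0" by (auto simp: symbol_def)
  have shift: "symbol q F G H d (v + (n * fst d, n * snd d))
      = q ^ (n * fst d * snd d) * symbol q F G H d v" for v n
    by (simp add: symbol_def FG algebra_simps power_add)
  from False have "symbol q F G H d (1, 0) \<noteq> 0 \<or> symbol q F G H d (0, 1) \<noteq> 0"
    by (auto simp: symbol_def FG H)
  then obtain v where "symbol q F G H d v \<noteq> 0" by blast
  then show ?thesis
    using q shift by (intro that[of v]) simp
qed

context quantum_coordinates
begin

text \<open>
  Compare the coordinates of \<open>z m\<close> and \<open>m z\<close> for \<open>m = x\<close> and \<open>m = y\<close>.
\<close>

lemma center_coord:
  assumes z: "z \<in> center A" and nz: "coord z t \<noteq> 0"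
  shows "q ^ fst t = 1 \<and> q ^ snd t = 1"
proof -
  have zc: "z \<in> carrier A" using z by (simp add: center_def)
  have eq: "coord z t * q ^ (snd t * fst r) = coord z t * q ^ (snd r * fst t)" for r
  proof -
    obtain m where m: "m \<in> carrier A" "\<And>s. coord m s = (if s = r then 1 else 0)"
      using ex_monomial by blast
    have "coord (z \<otimes>\<^bsub>A\<^esub> m) (t + r) = coord z t * coord m r * q ^ (snd t * fst r)"
      unfolding coord_mult[OF zc m(1)]
      by (rule sum_splits_single) (cases t; auto simp: m(2))+
    moreover have "coord (m \<otimes>\<^bsub>A\<^esub> z) (t + r) = coord m r * coord z t * q ^ (snd r * fst t)"
      unfolding coord_mult[OF m(1) zc]
      by (rule sum_splits_single) (cases t; auto simp: m(2) add.commute)+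
    ultimately show ?thesis
      using z m by (auto simp: center_def)
  qed
  from eq[of "(1, 0)"] eq[of "(0, 1)"] nz show ?thesis by auto
qed

lemma coord_commutator:
  assumes "a \<in> carrier A" "b \<in> carrier A"
  shows "coord (ad A a b) s
    = (\<Sum>(t, u)\<in>splits s. coord a t * (q ^ (snd t * fst u) - q ^ (snd u * fst t)) * coord b u)"
proof -
  have "coord (b \<otimes>\<^bsub>A\<^esub> a) s
    = (\<Sum>(t, u)\<in>splits s. coord b u * coord a t * q ^ (snd u * fst t))"
    unfolding coord_mult[OF assms(2,1)]
    by (rule sum.reindex_bij_witness[of _ prod.swap prod.swap]) (auto simp: splits_def add.commute)
  then show ?thesis
    using assms by (simp add: ad_def coord_diff coord_mult[OF assms] split_def
        sum_subtractf[symmetric] algebra_simps)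
qed

end

text \<open>
  The Euler derivations are diagonal: on the monomial of bidegree \<open>(i, j)\<close> the first acts as
  \<open>i\<close> and the second as \<open>j\<close>.
\<close>

locale euler_derivations = quantum_coordinates +
  fixes Dx Dy :: "'a \<Rightarrow> 'a"
  assumes Dx: "Dx \<in> Der A" "\<And>b s. b \<in> carrier A \<Longrightarrow> coord (Dx b) s = of_nat (fst s) * coord b s"
    and Dy: "Dy \<in> Der A" "\<And>b s. b \<in> carrier A \<Longrightarrow> coord (Dy b) s = of_nat (snd s) * coord b s"
begin

definition euler_ad :: "'a \<Rightarrow> 'a \<Rightarrow> 'a \<Rightarrow> 'a \<Rightarrow> 'a" where
  "euler_ad f g a = (\<lambda>b \<in> carrier A. f \<otimes>\<^bsub>A\<^esub> Dx b \<oplus>\<^bsub>A\<^esub> g \<otimes>\<^bsub>A\<^esub> Dy b \<oplus>\<^bsub>A\<^esub> ad A a b)"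

lemma ad_closed: "a \<in> carrier A \<Longrightarrow> b \<in> carrier A \<Longrightarrow> ad A a b \<in> carrier A"
  by (simp add: ad_def)

lemma coord_euler_ad:
  assumes "f \<in> carrier A" "g \<in> carrier A" "a \<in> carrier A" "b \<in> carrier A"
  shows "coord (euler_ad f g a b) s
    = (\<Sum>(t, u)\<in>splits s. symbol q (coord f) (coord g) (coord a) t u * coord b u)"
  using assms
  by (simp add: euler_ad_def coord_add coord_mult coord_commutator DerD(1) Dx Dy ad_closed
      sum.distrib[symmetric] split_def symbol_def algebra_simps)

text \<open>
  Otherwise a largest non-zero degree exists, and the leading monomials escape to infinity.
  A non-zero \<open>t\<close> forces the largest degree to be non-zero because \<open>0\<close> is the least bidegree.
\<close>

lemma symbol_eq_zero:
  assumes lf: "locally_finite A (euler_ad f g a)"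
    and fg: "f \<in> center A" "g \<in> center A" and a: "a \<in> carrier A" and t: "t \<noteq> 0"
  shows "symbol q (coord f) (coord g) (coord a) t u = 0"
proof (rule ccontr)
  let ?C = "symbol q (coord f) (coord g) (coord a)"
  assume nz: "?C t u \<noteq> 0"
  have fgc: "f \<in> carrier A" "g \<in> carrier A" using fg by (auto simp: center_def)
  let ?T = "{t. \<exists>u. ?C t u \<noteq> 0}"
  have "?T \<subseteq> {t. coord f t \<noteq> 0} \<union> {t. coord g t \<noteq> 0} \<union> {t. coord a t \<noteq> 0}"
    by (auto simp: symbol_def)
  then have fin: "finite ?T"
    by (rule finite_subset) (use finite_support fgc a in auto)
  define d where "d = Max ?T"
  have tT: "t \<in> ?T" using nz by blast
  then have "d \<in> ?T" unfolding d_def using fin by (intro Max_in) blast+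
  then obtain v where v: "?C d v \<noteq> 0" by blast
  have "t \<le> d" unfolding d_def using fin tT by (rule Max_ge)
  then have d: "d \<noteq> 0" using t by (cases t; cases d) (auto simp: zero_prod_def)
  obtain r where "\<And>n. ?C d (r + (n * fst d, n * snd d)) \<noteq> 0"
    by (rule symbol_nonvanishing_orbit[OF q_nonzero d _ v])
      (use center_coord[OF fg(1), of d] center_coord[OF fg(2), of d] in blast)+
  moreover have "t' \<le> d" if "?C t' u' \<noteq> 0" for t' u'
    unfolding d_def using that by (intro Max_ge fin) blast
  ultimately have "\<not> locally_finite A (euler_ad f g a)"
    using not_locally_finite_if_leading_symbol[OF coord_euler_ad[OF fgc a] _ d] by blast
  with lf show False by contradiction
qed

text \<open>
  Only the part of degree zero survives. There the commutator part has symbol zero, since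
  constants are central.
\<close>

lemma coord_locally_finite_euler_ad:
  assumes lf: "locally_finite A (euler_ad f g a)"
    and fg: "f \<in> center A" "g \<in> center A" and a: "a \<in> carrier A" and b: "b \<in> carrier A"
  shows "coord (euler_ad f g a b) s
    = (coord f 0 * of_nat (fst s) + coord g 0 * of_nat (snd s)) * coord b s"
proof -
  have fgc: "f \<in> carrier A" "g \<in> carrier A" using fg by (auto simp: center_def)
  let ?C = "symbol q (coord f) (coord g) (coord a)"
  have "coord (euler_ad f g a b) s = ?C 0 s * coord b s"
    unfolding coord_euler_ad[OF fgc a b]
  proof (rule sum_splits_single)
    fix t u assume "t + u = s" "(t, u) \<noteq> (0, s)"
    then have "t \<noteq> 0" by auto
    then show "?C t u * coord b u = 0"
      using symbol_eq_zero[OF lf fg a] by simp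
  qed simp
  then show ?thesis by (simp add: symbol_def)
qed

theorem locally_finite_euler_ad_iff:
  assumes D: "euler_ad f g a \<in> Der A"
    and fg: "f \<in> center A" "g \<in> center A" and a: "a \<in> carrier A"
  shows "locally_finite A (euler_ad f g a) \<longleftrightarrow>
    (\<exists>l m. euler_ad f g a = (\<lambda>b \<in> carrier A. l \<odot>\<^bsub>A\<^esub> Dx b \<oplus>\<^bsub>A\<^esub> m \<odot>\<^bsub>A\<^esub> Dy b))"
proof
  assume lf: "locally_finite A (euler_ad f g a)"
  have "euler_ad f g a = (\<lambda>b \<in> carrier A. coord f 0 \<odot>\<^bsub>A\<^esub> Dx b \<oplus>\<^bsub>A\<^esub> coord g 0 \<odot>\<^bsub>A\<^esub> Dy b)"
    (is "_ = ?E")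
  proof
    fix b
    show "euler_ad f g a b = ?E b"
    proof (cases "b \<in> carrier A")
      case True
      show ?thesis
      proof (rule coord_inject)
        fix s
        show "coord (euler_ad f g a b) s = coord (?E b) s"
          using True by (simp add: coord_locally_finite_euler_ad[OF lf fg a] coord_add coord_smult
              DerD(1) Dx Dy algebra_simps)
      qed (use True in \<open>auto simp: DerD(1)[OF D] DerD(1) Dx Dy\<close>)
    qed (simp add: euler_ad_def)
  qed
  then show "\<exists>l m. euler_ad f g a = (\<lambda>b \<in> carrier A. l \<odot>\<^bsub>A\<^esub> Dx b \<oplus>\<^bsub>A\<^esub> m \<odot>\<^bsub>A\<^esub> Dy b)"
    by blast
next
  assume "\<exists>l m. euler_ad f g a = (\<lambda>b \<in> carrier A. l \<odot>\<^bsub>A\<^esub> Dx b \<oplus>\<^bsub>A\<^esub> m \<odot>\<^bsub>A\<^esub> Dy b)"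
  then obtain l m where E: "euler_ad f g a = (\<lambda>b \<in> carrier A. l \<odot>\<^bsub>A\<^esub> Dx b \<oplus>\<^bsub>A\<^esub> m \<odot>\<^bsub>A\<^esub> Dy b)"
    by blast
  show "locally_finite A (euler_ad f g a)"
    by (rule locally_finite_if_support_preserving[OF D])
      (simp add: E coord_add coord_smult DerD(1) Dx Dy)
qed

theorem locally_finite_euler: "locally_finite A Dx" "locally_finite A Dy"
  by (rule locally_finite_if_support_preserving; simp add: Dx Dy)+

theorem locally_finite_ad_iff:
  assumes a: "a \<in> carrier A"
  shows "locally_finite A (ad A a) \<longleftrightarrow> a \<in> center A"
proof
  assume lf: "locally_finite A (ad A a)"
  have 0: "\<zero>\<^bsub>A\<^esub> \<in> center A" by (simp add: center_def)
  have "euler_ad \<zero>\<^bsub>A\<^esub> \<zero>\<^bsub>A\<^esub> a = ad A a"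
    unfolding euler_ad_def
    by (rule ext) (simp add: restrict_def DerD(1) Dx Dy ad_closed[OF a], simp add: ad_def)
  then have "coord (ad A a b) s = 0" if "b \<in> carrier A" for b s
    using coord_locally_finite_euler_ad[of "\<zero>\<^bsub>A\<^esub>" "\<zero>\<^bsub>A\<^esub>" a b s] lf 0 a that by simp
  then have "coord (a \<otimes>\<^bsub>A\<^esub> b) s = coord (b \<otimes>\<^bsub>A\<^esub> a) s" if "b \<in> carrier A" for b s
    using that a by (simp add: ad_def coord_diff)
  then have "a \<otimes>\<^bsub>A\<^esub> b = b \<otimes>\<^bsub>A\<^esub> a" if "b \<in> carrier A" for b
    using that a by (intro coord_inject) auto
  with a show "a \<in> center A" by (simp add: center_def)
next
  assume "a \<in> center A"
  then have ad: "ad A a = (\<lambda>b \<in> carrier A. \<zero>\<^bsub>A\<^esub>)"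
    by (auto simp: ad_def center_def a_minus_def M.r_neg)
  show "locally_finite A (ad A a)"
    by (rule locally_finite_if_support_preserving) (auto simp: ad Der_def)
qed

end

section \<open>Derivations that scale the generators\<close>

lemma qp_class_in_carrier [simp]: "qp_class q p \<in> carrier (quantum_plane q)"
  by (simp add: quantum_plane_simps)

text \<open>
  A derivation with \<open>g \<mapsto> wt g \<cdot> g\<close> on the generators multiplies every word by the total weight of
  its letters, by the Leibniz rule. The empty word needs \<open>D 1 = 0\<close>, which follows from
  \<open>1 = 1 \<cdot> 1\<close>.
\<close>

lemma derivation_word:
  fixes q :: "'k::field" and wt :: "gen \<Rightarrow> 'k"
  assumes D: "D \<in> Der (quantum_plane q)"
    and gen: "\<And>g. D (qp_class q (fa_gen g)) = wt g \<odot>\<^bsub>quantum_plane q\<^esub> qp_class q (fa_gen g)"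
  shows "D (qp_class q (Poly_Mapping.single (Word w) 1))
    = qp_class q (Poly_Mapping.single (Word w) (\<Sum>g\<leftarrow>w. wt g))"
proof (induction w)
  case Nil
  obtain e where e: "D (qp_class q 1) = qp_class q e"
    using DerD(1)[OF D qp_class_in_carrier] by (rule qp_carrierE)
  have "qp_class q e = qp_class q (e + e)"
    using DerD(4)[OF D qp_class_in_carrier qp_class_in_carrier, of 1 1]
    by (simp add: quantum_plane_simps e)
  then have "qp_coeff q e s = qp_coeff q e s + qp_coeff q e s" for s
    unfolding qp_class_eq_iff qp_coeff_add by blast
  then have "qp_coeff q e s = 0" for s
    by (metis add_cancel_left_right)
  then have "qp_class q e = qp_class q 0"
    by (simp add: qp_class_eq_iff)
  then show ?case
    using e by (simp add: zero_word_def[symmetric])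
next
  case (Cons g w)
  have cons: "Poly_Mapping.single (Word (g # w)) c = fa_gen g * Poly_Mapping.single (Word w) c"
    for c :: 'k
    by (simp add: fa_gen_def mult_single)
  show ?case
    using DerD(4)[OF D qp_class_in_carrier qp_class_in_carrier,
        of "fa_gen g" "Poly_Mapping.single (Word w) 1"]
    by (simp add: quantum_plane_simps Cons gen)
      (simp add: fa_gen_def fa_const_def mult_single zero_word_def Poly_Mapping.single_add)
qed

lemma derivation_coord:
  fixes q :: "'k::field" and wt :: "gen \<Rightarrow> 'k"
  assumes D: "D \<in> Der (quantum_plane q)"
    and gen: "\<And>g. D (qp_class q (fa_gen g)) = wt g \<odot>\<^bsub>quantum_plane q\<^esub> qp_class q (fa_gen g)"
    and b: "b \<in> carrier (quantum_plane q)"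
  shows "qp_coord q (D b) s = (of_nat (fst s) * wt GX + of_nat (snd s) * wt GY) * qp_coord q b s"
proof -
  have weight: "(\<Sum>g\<leftarrow>w. wt g) = of_nat (count_list w GX) * wt GX + of_nat (count_list w GY) * wt GY"
    for w
  proof (induction w)
    case (Cons g w)
    then show ?case by (cases g) (auto simp: algebra_simps)
  qed simp
  have word: "D (qp_class q (Poly_Mapping.single (Word w) c))
      = qp_class q (Poly_Mapping.single (Word w) (c * (\<Sum>g\<leftarrow>w. wt g)))" for w c
    using DerD(2)[OF D qp_class_in_carrier, of c "Poly_Mapping.single (Word w) 1"]
    by (simp add: derivation_word[OF D gen] quantum_plane_simps fa_const_def mult_single)
  obtain p where p: "b = qp_class q p" using b by (rule qp_carrierE)
  have "qp_coord q (D (qp_class q p)) s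
      = (of_nat (fst s) * wt GX + of_nat (snd s) * wt GY) * qp_coeff q p s"
  proof (induction p rule: poly_mapping_single_induct)
    case zero
    show ?case using word[of "[]" 0] by simp
  next
    case (single w c)
    obtain xs where "w = Word xs" by (cases w)
    then show ?case
      by (simp add: word qp_coeff_single weight)
  next
    case (add p r)
    obtain p' where "D (qp_class q p) = qp_class q p'"
      using DerD(1)[OF D qp_class_in_carrier] by (rule qp_carrierE)
    moreover obtain r' where "D (qp_class q r) = qp_class q r'"
      using DerD(1)[OF D qp_class_in_carrier] by (rule qp_carrierE)
    ultimately show ?case
      using add DerD(3)[OF D qp_class_in_carrier qp_class_in_carrier, of p r]
      by (simp add: quantum_plane_simps qp_coeff_add algebra_simps)
  qed
  then show ?thesis by (simp add: p)
qed

section \<open>Locally finite derivations of the quantum plane\<close>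

lemma quantum_plane_coordinates:
  fixes q :: "'k::field_char_0"
  assumes "q \<noteq> 0"
  shows "quantum_coordinates (quantum_plane q) q (qp_coord q)"
proof -
  interpret module "ring_of_type_algebra :: 'k ring" "quantum_plane q" by (rule module_quantum_plane)
  interpret ring "quantum_plane q" by (rule ring_quantum_plane)
  show ?thesis
  proof unfold_locales
    fix r :: "nat \<times> nat"
    have "bidegree (ordered_word r) = r \<and> inversions (ordered_word r) = 0"
    proof -
      have "inversions_list (replicate i GX @ replicate j GY) = 0" for i j
        by (induction i) (auto, induction j, auto)
      then show ?thesis by (cases r) simp
    qed
    then show "\<exists>m\<in>carrier (quantum_plane q). \<forall>s. qp_coord q m s = (if s = r then 1 else 0)"
      by (intro bexI[of _ "qp_class q (Poly_Mapping.single (ordered_word r) 1)"])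
        (simp_all add: qp_coeff_single)
  next
    fix a b assume "a \<in> carrier (quantum_plane q)" "b \<in> carrier (quantum_plane q)"
      "\<And>s. qp_coord q a s = qp_coord q b s"
    then show "a = b"
      by (elim qp_carrierE) (simp add: qp_class_eq_iff)
  next
    fix a c s assume "a \<in> carrier (quantum_plane q)"
    then obtain p where p: "a = qp_class q p" by (rule qp_carrierE)
    have "(\<Sum>(t, u)\<in>splits s. qp_coeff q (fa_const c) t * qp_coeff q p u * q ^ (snd t * fst u))
        = qp_coeff q (fa_const c) 0 * qp_coeff q p s * q ^ (snd (0 :: nat \<times> nat) * fst s)"
      by (rule sum_splits_single) (auto simp: fa_const_def qp_coeff_single zero_word_def zero_prod_def)
    then show "qp_coord q (c \<odot>\<^bsub>quantum_plane q\<^esub> a) s = c * qp_coord q a s"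
      by (simp add: p quantum_plane_simps qp_coeff_mult)
        (simp add: fa_const_def qp_coeff_single zero_word_def zero_prod_def)
  next
    fix a assume "a \<in> carrier (quantum_plane q)"
    then show "finite {s. qp_coord q a s \<noteq> 0}"
      by (elim qp_carrierE) (simp add: finite_qp_coeff)
  qed (auto elim!: qp_carrierE simp: quantum_plane_simps assms qp_coeff_add qp_coeff_mult)
qed

theorem theorem2:
  fixes q :: "'k::{alg_closed_field, field_char_0}"
    and A :: "('k, 'k free_alg set) module" (structure)
    and x y :: "'k free_alg set"
    and Dx Dy :: "'k free_alg set \<Rightarrow> 'k free_alg set"
  assumes q: "q \<noteq> 0" "q \<noteq> 1"
    and A: "A = quantum_plane q"
    and xy: "x = qp_gen q GX" "y = qp_gen q GY"
    and Dx: "Dx \<in> Der A" "Dx x = x" "Dx y = \<zero>"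
    and Dy: "Dy \<in> Der A" "Dy x = \<zero>" "Dy y = y"
  shows "(locally_finite A Dx \<and> locally_finite A Dy) \<and>
    (\<forall>a \<in> carrier A. locally_finite A (ad A a) \<longleftrightarrow> a \<in> center A) \<and>
    (\<forall>D \<in> Der A. \<forall>f \<in> center A. \<forall>g \<in> center A. \<forall>a \<in> carrier A.
       D = (\<lambda>b \<in> carrier A. f \<otimes> Dx b \<oplus> g \<otimes> Dy b \<oplus> ad A a b) \<longrightarrow>
       (locally_finite A D \<longleftrightarrow>
         (\<exists>l m :: 'k. D = (\<lambda>b \<in> carrier A. l \<odot> Dx b \<oplus> m \<odot> Dy b))))"
proof -
  have class_xy: "x = qp_class q (fa_gen GX)" "y = qp_class q (fa_gen GY)"
    by (simp_all add: xy qp_gen_def qp_class_def)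
  have const: "fa_const 0 * p = (0 :: 'k free_alg)" "fa_const 1 * p = p" for p
    by (simp_all add: fa_const_def)
  have wx: "Dx (qp_class q (fa_gen g)) = (if g = GX then 1 else 0) \<odot> qp_class q (fa_gen g)" for g
    using Dx class_xy by (cases g) (simp_all add: A quantum_plane_simps const)
  have wy: "Dy (qp_class q (fa_gen g)) = (if g = GY then 1 else 0) \<odot> qp_class q (fa_gen g)" for g
    using Dy class_xy by (cases g) (simp_all add: A quantum_plane_simps const)
  interpret quantum_coordinates A q "qp_coord q"
    unfolding A by (rule quantum_plane_coordinates[OF q(1)])
  interpret euler_derivations A q "qp_coord q" Dx Dy
  proof
    fix b s assume b: "b \<in> carrier A"
    show "qp_coord q (Dx b) s = of_nat (fst s) * qp_coord q b s"
      using derivation_coord[OF Dx(1)[unfolded A] wx[unfolded A] b[unfolded A]] by simp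
    show "qp_coord q (Dy b) s = of_nat (snd s) * qp_coord q b s"
      using derivation_coord[OF Dy(1)[unfolded A] wy[unfolded A] b[unfolded A]] by simp
  qed (rule Dx Dy)+
  show ?thesis
  proof (intro conjI ballI impI)
    show "locally_finite A Dx" "locally_finite A Dy" by (rule locally_finite_euler)+
    show "locally_finite A (ad A a) \<longleftrightarrow> a \<in> center A" if "a \<in> carrier A" for a
      using that by (rule locally_finite_ad_iff)
    fix D f g a
    assume D: "D \<in> Der A" and fga: "f \<in> center A" "g \<in> center A" "a \<in> carrier A"
      and "D = (\<lambda>b \<in> carrier A. f \<otimes> Dx b \<oplus> g \<otimes> Dy b \<oplus> ad A a b)"
    then have "D = euler_ad f g a" by (simp add: euler_ad_def)
    then show "locally_finite A D \<longleftrightarrow> (\<exists>l m. D = (\<lambda>b \<in> carrier A. l \<odot> Dx b \<oplus> m \<odot> Dy b))"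
      using locally_finite_euler_ad_iff[of f g a] D fga by simp
  qed
qed

end
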